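(* Let $(P_1,\dots,P_d)\sim\text{Vec-NIFPP}(q_M,H,P_0)$ and let $A\subset\Theta$ be a measurable set with $0<P_0(A)<1$. Then for any $j,l\in\{1,\dots,d\}$, $$\operatorname{corr}(P_j(A),P_l(A))=\frac{\mathbb P\left(K_{(1,1)}=1\right)}{\sqrt{\mathbb P\left(K_{j,(2)}=1\right)\mathbb P\left(K_{l,(2)}=1\right)}}.$$ Here $K_{(1,1)}$ is the number of distinct values in $\{X,Y\}$, where conditionally on $(P_1,\dots,P_d)$ the variables $X\sim P_j$ and $Y\sim P_l$ are independent, and $K_{j,(2)}$ is the number of distinct values among two conditionally i.i.d. draws from $P_j$ (so $\mathbb P(K_{j,(2)}=1)$ is the prior probability of a single local cluster out of two observations in group $j$). In particular the correlation does not depend on $A$.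
   Context: Setting. $d\ge1$ is an integer, $\Theta\subset\mathbb R^s$ is a (Borel) parameter space, $P_0$ is a diffuse (non-atomic) probability measure on $\Theta$, $q_M$ is a probability mass function on $\{1,2,3,\dots\}$, and $H=H_1\times\dots\times H_d$, where $H_j(\mathrm ds)=h(s\mid\gamma_j)\,\mathrm ds$ are probability distributions on $(0,\infty)$ with densities from a common parametric family, with parameters $\gamma_j>0$. Let $M\sim q_M$; conditionally on $M$, let $S_{j,m}$ ($1\le j\le d$, $1\le m\le M$) be independent with $S_{j,m}\sim H_j$, and let $\tau_1,\dots,\tau_M$ be i.i.d. from $P_0$, independent of the $S_{j,m}$. Put $\mu_j=\sum_{m=1}^M S_{j,m}\delta_{\tau_m}$ and $P_j=\mu_j/\mu_j(\Theta)$. The law of $(P_1,\dots,P_d)$ is denoted $\text{Vec-NIFPP}(q_M,H,P_0)$. $\operatorname{corr}$ denotes Pearson correlation. *)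

theory Defs
  imports "HOL-Probability.Probability"
begin

abbreviation borel_on :: "'a::topological_space set \<Rightarrow> 'a measure" where
  "borel_on \<Theta> \<equiv> restrict_space borel \<Theta>"

definition diffuse :: "'a measure \<Rightarrow> bool" where
  "diffuse N \<longleftrightarrow> (\<forall>x\<in>space N. {x} \<in> sets N \<and> emeasure N {x} = 0)"

text \<open>The measure with Lebesgue density \<open>f\<close> on the half-line; its underlying space
  is \<open>{0<..}\<close>, so weights drawn from it are surely positive.\<close>
definition half_line_law :: "(real \<Rightarrow> real) \<Rightarrow> real measure" where
  "half_line_law f = density (restrict_space lborel {0<..}) (\<lambda>s. ennreal (f s))"

text \<open>The finite measure \<open>\<Sum>i=1..m. s i \<cdot> \<delta>(t i)\<close> on \<open>\<Theta>\<close>, built as the image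
  under \<open>t\<close> of the measure on \<open>{1..m}\<close> with point masses \<open>s i\<close>;
  cf. \<open>emeasure_weighted_atoms\<close> below.\<close>
definition weighted_atoms ::
  "'a::topological_space set \<Rightarrow> nat \<Rightarrow> (nat \<Rightarrow> real) \<Rightarrow> (nat \<Rightarrow> 'a) \<Rightarrow> 'a measure" where
  "weighted_atoms \<Theta> m s t = distr (point_measure {1..m} (\<lambda>i. ennreal (s i))) (borel_on \<Theta>) t"

lemma sets_weighted_atoms [simp]: "sets (weighted_atoms \<Theta> m s t) = sets (borel_on \<Theta>)"
  by (simp add: weighted_atoms_def)

lemma space_weighted_atoms [simp]: "space (weighted_atoms \<Theta> m s t) = \<Theta>"
  by (simp add: weighted_atoms_def space_restrict_space)

lemma emeasure_weighted_atoms: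
  assumes "\<And>i. i \<in> {1..m} \<Longrightarrow> t i \<in> \<Theta>" and "B \<in> sets (borel_on \<Theta>)"
  shows "emeasure (weighted_atoms \<Theta> m s t) B = (\<Sum>i=1..m. ennreal (s i) * indicator B (t i))"
proof -
  have t: "t \<in> measurable (point_measure {1..m} (\<lambda>i. ennreal (s i))) (borel_on \<Theta>)"
    using assms(1) by (auto simp: space_restrict_space)
  have "emeasure (weighted_atoms \<Theta> m s t) B
      = emeasure (point_measure {1..m} (\<lambda>i. ennreal (s i))) {i\<in>{1..m}. t i \<in> B}"
    unfolding weighted_atoms_def
    by (subst emeasure_distr[OF t assms(2)])
       (auto simp: space_point_measure intro!: arg_cong[where f = "emeasure _"])
  also have "\<dots> = (\<Sum>i | i \<in> {1..m} \<and> t i \<in> B. ennreal (s i))"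
    by (subst emeasure_point_measure_finite) auto
  also have "\<dots> = (\<Sum>i=1..m. ennreal (s i) * indicator B (t i))"
    by (rule sum.mono_neutral_cong_left) auto
  finally show ?thesis .
qed

definition normalized :: "'a measure \<Rightarrow> 'a measure" where
  "normalized \<mu> = scale_measure (1 / emeasure \<mu> (space \<mu>)) \<mu>"

text \<open>The measurable space of vectors \<open>(p\<^sub>1, \<dots>, p\<^sub>d)\<close> of probability measures on \<open>\<Theta>\<close>.\<close>
abbreviation prob_vectors ::
  "nat \<Rightarrow> 'a::topological_space set \<Rightarrow> (nat \<Rightarrow> 'a measure) measure" where
  "prob_vectors d \<Theta> \<equiv> PiM {1..d} (\<lambda>j. prob_algebra (borel_on \<Theta>))"

text \<open>Conditional law of \<open>(P\<^sub>1, \<dots>, P\<^sub>d)\<close> given that there are \<open>m\<close> atoms. The value at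
  \<open>m = 0\<close> is junk.\<close>
definition nifpp_given ::
  "nat \<Rightarrow> 'a::topological_space set \<Rightarrow> (nat \<Rightarrow> real measure) \<Rightarrow> 'a measure \<Rightarrow> nat
    \<Rightarrow> (nat \<Rightarrow> 'a measure) measure" where
  "nifpp_given d \<Theta> H P0 m =
     distr (PiM ({1..d} \<times> {1..m}) (\<lambda>(j, i). H j) \<Otimes>\<^sub>M PiM {1..m} (\<lambda>i. P0))
       (prob_vectors d \<Theta>)
       (\<lambda>(S, \<tau>). \<lambda>j\<in>{1..d}. normalized (weighted_atoms \<Theta> m (\<lambda>i. S (j, i)) \<tau>))"

definition vec_nifpp ::
  "nat \<Rightarrow> 'a::topological_space set \<Rightarrow> nat pmf \<Rightarrow> (nat \<Rightarrow> real measure) \<Rightarrow> 'a measure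
    \<Rightarrow> (nat \<Rightarrow> 'a measure) measure" where
  "vec_nifpp d \<Theta> q H P0 = measure_pmf q \<bind> nifpp_given d \<Theta> H P0"

text \<open>Conditionally on the random vector \<open>P\<close>, the variables \<open>X\<close> and \<open>Y\<close> are independent
  with laws \<open>P\<^sub>j\<close> and \<open>P\<^sub>l\<close>; for \<open>j = l\<close> they are conditionally i.i.d. from \<open>P\<^sub>j\<close>.\<close>
definition cond_indep_draws ::
  "'w measure \<Rightarrow> nat \<Rightarrow> 'a::topological_space set \<Rightarrow> ('w \<Rightarrow> nat \<Rightarrow> 'a measure)
    \<Rightarrow> nat \<Rightarrow> nat \<Rightarrow> ('w \<Rightarrow> 'a) \<Rightarrow> ('w \<Rightarrow> 'a) \<Rightarrow> bool" where
  "cond_indep_draws \<Omega> d \<Theta> P j l X Y \<longleftrightarrow>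
     X \<in> measurable \<Omega> (borel_on \<Theta>) \<and> Y \<in> measurable \<Omega> (borel_on \<Theta>) \<and>
     (\<forall>V\<in>sets (prob_vectors d \<Theta>). \<forall>B\<in>sets (borel_on \<Theta>). \<forall>C\<in>sets (borel_on \<Theta>).
        measure \<Omega> {\<omega>\<in>space \<Omega>. P \<omega> \<in> V \<and> X \<omega> \<in> B \<and> Y \<omega> \<in> C} =
        (\<integral>\<omega>. indicator V (P \<omega>) * measure (P \<omega> j) B * measure (P \<omega> l) C \<partial>\<Omega>))"

definition distinct_count :: "('w \<Rightarrow> 'a) \<Rightarrow> ('w \<Rightarrow> 'a) \<Rightarrow> 'w \<Rightarrow> nat" where
  "distinct_count X Y \<omega> = card {X \<omega>, Y \<omega>}"

definition covariance :: "'w measure \<Rightarrow> ('w \<Rightarrow> real) \<Rightarrow> ('w \<Rightarrow> real) \<Rightarrow> real" where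
  "covariance \<Omega> U V =
     (\<integral>\<omega>. (U \<omega> - integral\<^sup>L \<Omega> U) * (V \<omega> - integral\<^sup>L \<Omega> V) \<partial>\<Omega>)"

definition corr :: "'w measure \<Rightarrow> ('w \<Rightarrow> real) \<Rightarrow> ('w \<Rightarrow> real) \<Rightarrow> real" where
  "corr \<Omega> U V = covariance \<Omega> U V / sqrt (covariance \<Omega> U U * covariance \<Omega> V V)"

end

(* Write w_{k,i} = S_{k,i} / sum_i S_{k,i} for the normalized weights. Integrating out the atoms
   first, the terms of P_j(B) P_l(C) sharing an atom contribute P0(B \<inter> C) and the others
   P0(B) P0(C), so E[P_j(B) P_l(C)] = c P0(B \<inter> C) + (1 - c) P0(B) P0(C) with
   c = E[sum_i w_{j,i} w_{l,i}]. Taking B = C gives Cov(P_j(A), P_l(A)) = c P0(A) (1 - P0(A)).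
   The same identity says that the law of (X, Y) is the mixture of the diagonal image of P0 and of
   P0 \<otimes> P0 with weights c and 1 - c; as P0 is diffuse, P(X = Y) = c. *)
theory Submission
  imports Defs
begin

text \<open>Each \<open>b i\<close> is at most the whole sum of \<open>b\<close>. Applied to the
  weights of two groups, this keeps the overlap of their normalized weights below 1.\<close>

lemma sum_mult_le_mult_sum:
  fixes a b :: "'i \<Rightarrow> real"
  assumes "finite I" "\<And>i. i \<in> I \<Longrightarrow> 0 \<le> a i" "\<And>i. i \<in> I \<Longrightarrow> 0 \<le> b i"
  shows "(\<Sum>i\<in>I. a i * b i) \<le> sum a I * sum b I"
proof -
  have "(\<Sum>i\<in>I. a i * b i) \<le> (\<Sum>i\<in>I. a i * sum b I)"
    using assms by (intro sum_mono mult_left_mono member_le_sum) auto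
  then show ?thesis
    by (simp add: sum_distrib_right)
qed

section \<open>Values and total mass of normalized atomic measures\<close>

lemma sets_half_line_law [simp]: "sets (half_line_law f) = sets (borel_on {0<..})"
  by (simp add: half_line_law_def cong: sets_restrict_space_cong)

lemma sets_normalized [simp]: "sets (normalized \<mu>) = sets \<mu>"
  by (simp add: normalized_def)

lemma space_normalized [simp]: "space (normalized \<mu>) = space \<mu>"
  by (simp add: normalized_def space_scale_measure)

text \<open>Positive weights and at least one atom make the total mass positive and finite, so the
  extended quotient in \<open>normalized\<close> is the image of an ordinary real quotient.\<close>

lemma emeasure_normalized_weighted_atoms:
  assumes t: "\<And>i. i \<in> {1..m} \<Longrightarrow> t i \<in> \<Theta>"
    and s: "\<And>i. i \<in> {1..m} \<Longrightarrow> 0 < s i" and m: "1 \<le> m"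
    and B: "B \<in> sets (borel_on \<Theta>)"
  shows "emeasure (normalized (weighted_atoms \<Theta> m s t)) B =
    ennreal ((\<Sum>i=1..m. s i * indicator B (t i)) / (\<Sum>i=1..m. s i))"
proof -
  have *: "emeasure (weighted_atoms \<Theta> m s t) C = ennreal (\<Sum>i=1..m. s i * indicator C (t i))"
    if "C \<in> sets (borel_on \<Theta>)" for C
  proof -
    have "(\<Sum>i=1..m. ennreal (s i) * indicator C (t i)) = (\<Sum>i=1..m. ennreal (s i * indicator C (t i)))"
      by (intro sum.cong) (auto split: split_indicator)
    also have "\<dots> = ennreal (\<Sum>i=1..m. s i * indicator C (t i))"
      using s by (intro sum_ennreal) (auto simp: less_imp_le)
    finally show ?thesis
      by (subst emeasure_weighted_atoms[OF t that])
  qed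
  have pos: "0 < (\<Sum>i=1..m. s i)"
    using s m by (intro sum_pos) auto
  have "\<Theta> \<in> sets (borel_on \<Theta>)"
    using sets.top[of "borel_on \<Theta>"] by (simp add: space_restrict_space)
  then have "emeasure (weighted_atoms \<Theta> m s t) \<Theta> = ennreal (\<Sum>i=1..m. s i)"
    using t by (subst *) (auto intro!: arg_cong[where f = ennreal] sum.cong)
  moreover have "0 \<le> (\<Sum>i=1..m. s i * indicator B (t i))"
    using s by (intro sum_nonneg) (auto simp: less_imp_le)
  ultimately show ?thesis
    using pos by (simp add: normalized_def *[OF B] divide_ennreal ennreal_mult[symmetric] flip: ennreal_1)
qed

lemma measure_normalized_weighted_atoms:
  assumes t: "\<And>i. i \<in> {1..m} \<Longrightarrow> t i \<in> \<Theta>"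
    and s: "\<And>i. i \<in> {1..m} \<Longrightarrow> 0 < s i" and m: "1 \<le> m"
    and B: "B \<in> sets (borel_on \<Theta>)"
  shows "measure (normalized (weighted_atoms \<Theta> m s t)) B =
    (\<Sum>i=1..m. s i * indicator B (t i)) / (\<Sum>i=1..m. s i)"
proof -
  have "0 \<le> (\<Sum>i=1..m. s i * indicator B (t i)) / (\<Sum>i=1..m. s i)"
    using s by (intro divide_nonneg_nonneg sum_nonneg) (auto simp: less_imp_le)
  then show ?thesis
    unfolding measure_def using emeasure_normalized_weighted_atoms[OF assms] by simp
qed

lemma prob_space_normalized_weighted_atoms:
  assumes t: "\<And>i. i \<in> {1..m} \<Longrightarrow> t i \<in> \<Theta>"
    and s: "\<And>i. i \<in> {1..m} \<Longrightarrow> 0 < s i" and m: "1 \<le> m"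
  shows "prob_space (normalized (weighted_atoms \<Theta> m s t))"
proof
  have pos: "0 < (\<Sum>i=1..m. s i)"
    using s m by (intro sum_pos) auto
  have B: "\<Theta> \<in> sets (borel_on \<Theta>)"
    using sets.top[of "borel_on \<Theta>"] by (simp add: space_restrict_space)
  have "(\<Sum>i=1..m. s i * indicator \<Theta> (t i)) = (\<Sum>i=1..m. s i)"
    using t by (intro sum.cong) auto
  then show "emeasure (normalized (weighted_atoms \<Theta> m s t))
      (space (normalized (weighted_atoms \<Theta> m s t))) = 1"
    using pos emeasure_normalized_weighted_atoms[where s = s and t = t, OF t s m B] by simp
qed

section \<open>Product moments, mixtures and ties\<close>

lemma integral_indicator_pair_PiM:
  assumes N: "prob_space N" and I: "finite I" "i \<in> I" "k \<in> I"
    and B: "B \<in> sets N" and C: "C \<in> sets N"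
  shows "(\<integral>x. indicator B (x i) * indicator C (x k) \<partial>PiM I (\<lambda>_. N)) =
    (if i = k then measure N (B \<inter> C) else measure N B * measure N C)"
proof -
  interpret N: prob_space N by fact
  interpret finite_product_prob_space "\<lambda>_. N" I
    by standard fact
  \<comment> \<open>The event is a box whose sides are restricted only at the coordinates
    \<open>i\<close> and \<open>k\<close>. When \<open>i = k\<close> both restrictions fall on one
    side and give \<open>B \<inter> C\<close>; otherwise they stay apart and the probability
    factorizes.\<close>
  define Z where "Z n = (if n = i then B else space N) \<inter> (if n = k then C else space N)" for n
  have Z: "Z n \<in> sets N" for n
    using B C by (auto simp: Z_def)
  have BC: "B \<subseteq> space N" "C \<subseteq> space N"
    using B C by (auto dest: sets.sets_into_space)
  have "(\<integral>x. indicator B (x i) * indicator C (x k) \<partial>PiM I (\<lambda>_. N))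
      = (\<integral>x. (indicator :: _ \<Rightarrow> _ \<Rightarrow> real) (Pi\<^sub>E I Z) x \<partial>PiM I (\<lambda>_. N))"
  proof (rule Bochner_Integration.integral_cong[OF refl])
    fix x assume "x \<in> space (PiM I (\<lambda>_. N))"
    then have "x \<in> Pi\<^sub>E I Z \<longleftrightarrow> x i \<in> B \<and> x k \<in> C"
      using I BC by (auto simp: space_PiM Z_def PiE_iff extensional_def)
    then show "indicator B (x i) * indicator C (x k) = (indicator (Pi\<^sub>E I Z) x :: real)"
      by (auto simp: indicator_def)
  qed
  also have "\<dots> = prob (Pi\<^sub>E I Z)"
    using sets_PiM_I_finite[OF I(1), of Z "\<lambda>_. N"] Z by simp
  also have "\<dots> = (\<Prod>n\<in>I. measure N (Z n))"
    using Z by (intro prob_times)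
  also have "\<dots> = (\<Prod>n\<in>{i, k}. measure N (Z n))"
    using I by (intro prod.mono_neutral_right) (auto simp: Z_def N.prob_space)
  also have "\<dots> = (if i = k then measure N (B \<inter> C) else measure N B * measure N C)"
    using BC by (auto simp: Z_def Int_absorb1 Int_absorb2)
  finally show ?thesis .
qed

text \<open>Dynkin's argument: the sets on which the identity holds are closed under complements and
  disjoint countable unions, and \<open>G\<close> is an intersection-stable generator. The identity
  is kept as an equation between real values, so \<open>c\<close> may be any real number and no
  mixture measure has to be constructed.\<close>

lemma measure_mixture_eqI:
  assumes M: "prob_space M" "prob_space N1" "prob_space N2"
    and sets: "sets M = sigma_sets S G" "sets N1 = sigma_sets S G" "sets N2 = sigma_sets S G"
    and G: "Int_stable G" "G \<subseteq> Pow S"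
    and eq: "\<And>D. D \<in> G \<Longrightarrow> measure M D = c * measure N1 D + (1 - c) * measure N2 D"
    and D: "D \<in> sets M"
  shows "measure M D = c * measure N1 D + (1 - c) * measure N2 D"
proof -
  interpret M: prob_space M by fact
  interpret N1: prob_space N1 by fact
  interpret N2: prob_space N2 by fact
  have space: "space M = S" "space N1 = S" "space N2 = S"
    using sets G(2) by (metis sets_eq_imp_space_eq sets_measure_of space_measure_of)+
  from G D[unfolded sets] show ?thesis
  proof (induct rule: sigma_sets_induct_disjoint)
    \<comment> \<open>Complements preserve the identity because the coefficients \<open>c\<close>
      and \<open>1 - c\<close> add up to 1, the common total mass.\<close>
    case (compl A)
    have "measure M (S - A) = 1 - measure M A" "measure N1 (S - A) = 1 - measure N1 A"
      "measure N2 (S - A) = 1 - measure N2 A"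
      using compl(1) M.prob_compl[of A] N1.prob_compl[of A] N2.prob_compl[of A]
      by (simp_all add: sets space)
    then show ?case
      unfolding compl(2) by (simp only:) (simp add: algebra_simps)
  next
    case (union A)
    have "(\<lambda>i. measure M (A i)) sums measure M (\<Union>i. A i)"
      "(\<lambda>i. measure N1 (A i)) sums measure N1 (\<Union>i. A i)"
      "(\<lambda>i. measure N2 (A i)) sums measure N2 (\<Union>i. A i)"
      using union(1,2) sets
      by (auto intro!: M.finite_measure_UNION N1.finite_measure_UNION N2.finite_measure_UNION)
    moreover from this have "(\<lambda>i. c * measure N1 (A i) + (1 - c) * measure N2 (A i)) sums
        (c * measure N1 (\<Union>i. A i) + (1 - c) * measure N2 (\<Union>i. A i))"
      by (intro sums_add sums_mult)
    ultimately show ?case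
      using union(3) by (simp add: sums_iff)
  qed (use eq in auto)
qed

text \<open>Rectangles are intersection-stable and generate the product sigma-algebra, so the
  hypothesis on them extends to the diagonal \<open>D\<close>. There \<open>T\<close>, the law of
  (x, x), has mass 1 and the product law has mass 0, which leaves \<open>c\<close>.\<close>

lemma prob_tie_eq_mixture_weight:
  fixes N :: "'a::{second_countable_topology, t2_space} measure"
  assumes \<Omega>: "prob_space \<Omega>" and N: "prob_space N" "diffuse N"
    and borel: "(\<lambda>x. x) \<in> borel_measurable N"
    and X: "X \<in> measurable \<Omega> N" and Y: "Y \<in> measurable \<Omega> N"
    and eq: "\<And>B C. B \<in> sets N \<Longrightarrow> C \<in> sets N \<Longrightarrow>
      measure \<Omega> {\<omega>\<in>space \<Omega>. X \<omega> \<in> B \<and> Y \<omega> \<in> C} =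
      c * measure N (B \<inter> C) + (1 - c) * (measure N B * measure N C)"
  shows "measure \<Omega> {\<omega>\<in>space \<Omega>. X \<omega> = Y \<omega>} = c"
proof -
  interpret \<Omega>: prob_space \<Omega> by fact
  interpret N: prob_space N by fact
  interpret NN: pair_prob_space N N ..
  note [measurable] = X Y
  define L where "L = distr \<Omega> (N \<Otimes>\<^sub>M N) (\<lambda>\<omega>. (X \<omega>, Y \<omega>))"
  define T where "T = distr N (N \<Otimes>\<^sub>M N) (\<lambda>x. (x, x))"
  define G where "G = {B \<times> C | B C. B \<in> sets N \<and> C \<in> sets N}"
  define D where "D = {p \<in> space (N \<Otimes>\<^sub>M N). fst p = snd p}"
  have [measurable]: "fst \<in> borel_measurable (N \<Otimes>\<^sub>M N)" "snd \<in> borel_measurable (N \<Otimes>\<^sub>M N)"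
    using measurable_compose[OF measurable_fst borel] measurable_compose[OF measurable_snd borel]
    by auto
  \<comment> \<open>The diagonal is closed since the space is Hausdorff, and second countability
    puts it into the product sigma-algebra.\<close>
  have D: "D \<in> sets (N \<Otimes>\<^sub>M N)"
    unfolding D_def by measurable
  have "measure L D = c * measure T D + (1 - c) * measure (N \<Otimes>\<^sub>M N) D"
  proof (rule measure_mixture_eqI)
    show "prob_space L" "prob_space T" "prob_space (N \<Otimes>\<^sub>M N)"
      unfolding L_def T_def by (auto intro!: \<Omega>.prob_space_distr N.prob_space_distr NN.prob_space_axioms)
    show "sets L = sigma_sets (space N \<times> space N) G" "sets T = sigma_sets (space N \<times> space N) G"
      "sets (N \<Otimes>\<^sub>M N) = sigma_sets (space N \<times> space N) G"
      by (simp_all add: L_def T_def G_def sets_pair_measure)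
    show "Int_stable G"
      unfolding G_def by (rule Int_stable_pair_measure_generator)
    show "G \<subseteq> Pow (space N \<times> space N)"
      unfolding G_def by (rule pair_measure_closed)
    show "D \<in> sets L"
      using D by (simp add: L_def)
  next
    fix R assume "R \<in> G"
    then obtain B C where R: "R = B \<times> C" and [measurable]: "B \<in> sets N" "C \<in> sets N"
      by (auto simp: G_def)
    have "measure L R = measure \<Omega> {\<omega>\<in>space \<Omega>. X \<omega> \<in> B \<and> Y \<omega> \<in> C}"
      unfolding L_def R by (subst measure_distr) (auto intro!: arg_cong[where f = "measure _"])
    moreover have "measure T R = measure N (B \<inter> C)"
      unfolding T_def R using sets.sets_into_space[of B N]
      by (subst measure_distr) (auto intro!: arg_cong[where f = "measure _"])
    moreover have "measure (N \<Otimes>\<^sub>M N) R = measure N B * measure N C"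
      unfolding R by (simp add: measure_def N.emeasure_pair_measure_Times enn2real_mult)
    ultimately show "measure L R = c * measure T R + (1 - c) * measure (N \<Otimes>\<^sub>M N) R"
      by (simp add: eq)
  qed
  moreover have "measure L D = measure \<Omega> {\<omega>\<in>space \<Omega>. X \<omega> = Y \<omega>}"
    unfolding L_def using D measurable_space[OF X] measurable_space[OF Y]
    by (subst measure_distr) (auto simp: D_def space_pair_measure intro!: arg_cong[where f = "measure _"])
  moreover have "measure T D = 1"
  proof -
    have "(\<lambda>x. (x, x)) -` D \<inter> space N = space N"
      by (auto simp: D_def space_pair_measure)
    then show ?thesis
      unfolding T_def using D by (subst measure_distr) (auto simp: N.prob_space)
  qed
  moreover have "measure (N \<Otimes>\<^sub>M N) D = 0"
  proof -
    \<comment> \<open>Fubini over sections: the diagonal meets the fibre over x in the single point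
      x, which is a null set because \<open>N\<close> is diffuse.\<close>
    have "Pair x -` D = {x}" if "x \<in> space N" for x
      using that by (auto simp: D_def space_pair_measure)
    then have "emeasure (N \<Otimes>\<^sub>M N) D = (\<integral>\<^sup>+x. emeasure N {x} \<partial>N)"
      by (subst N.emeasure_pair_measure_alt[OF D]) (auto intro!: nn_integral_cong)
    also have "\<dots> = (\<integral>\<^sup>+x. 0 \<partial>N)"
      using N(2) by (intro nn_integral_cong) (auto simp: diffuse_def)
    finally show ?thesis
      by (simp add: measure_def)
  qed
  ultimately show ?thesis
    by simp
qed

text \<open>This is the mixture weight given \<open>m\<close> atoms: the mean inner product of the
  normalized weight vectors of groups \<open>j\<close> and \<open>l\<close>, that is, the
  probability that independent picks of an atom index by these two weight vectors coincide.\<close>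

definition mean_weight_overlap :: "nat \<Rightarrow> (nat \<Rightarrow> real measure) \<Rightarrow> nat \<Rightarrow> nat \<Rightarrow> nat \<Rightarrow> real" where
  "mean_weight_overlap d H j l m =
    (\<integral>S. (\<Sum>i=1..m. S (j, i) * S (l, i)) / ((\<Sum>i=1..m. S (j, i)) * (\<Sum>i=1..m. S (l, i)))
      \<partial>PiM ({1..d} \<times> {1..m}) (\<lambda>(k, i). H k))"

section \<open>The model: laws of weights and atoms, measurability, conditioning on the number of
  atoms\<close>

locale nifpp_setting =
  fixes d :: nat and \<Theta> :: "'a::{second_countable_topology, t2_space} set"
    and H :: "nat \<Rightarrow> real measure" and P0 :: "'a measure"
  assumes sets_P0: "sets P0 = sets (borel_on \<Theta>)" and prob_P0: "prob_space P0"
    and sets_H: "\<And>k. k \<in> {1..d} \<Longrightarrow> sets (H k) = sets (borel_on {0<..})"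
    and prob_H: "\<And>k. k \<in> {1..d} \<Longrightarrow> prob_space (H k)"
begin

declare One_nat_def [simp del]

abbreviation "weight_law (m :: nat) \<equiv> PiM ({1..d} \<times> {1..m}) (\<lambda>(k, i). H k)"
abbreviation "atom_law (m :: nat) \<equiv> PiM {1..m} (\<lambda>i. P0)"
abbreviation "joint_law m \<equiv> weight_law m \<Otimes>\<^sub>M atom_law m"

lemma space_P0: "space P0 = \<Theta>"
  using sets_eq_imp_space_eq[OF sets_P0] by (simp add: space_restrict_space)

lemma prob_weight_law: "prob_space (weight_law m)"
  by (intro prob_space_PiM) (auto intro: prob_H)

lemma prob_atom_law: "prob_space (atom_law m)"
  by (intro prob_space_PiM prob_P0)

lemma prob_joint_law: "prob_space (joint_law m)"
proof -
  interpret W: prob_space "weight_law m" by (rule prob_weight_law)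
  interpret T: prob_space "atom_law m" by (rule prob_atom_law)
  interpret pair_prob_space "weight_law m" "atom_law m" ..
  show ?thesis by (rule prob_space_axioms)
qed

text \<open>The sigma-algebra of \<open>H k\<close> determines its space, the open half-line.
  Positivity therefore holds surely and not just almost surely, and for \<open>m \<ge> 1\<close> the
  division by a total weight is legitimate at every point.\<close>

lemma weight_pos:
  assumes "S \<in> space (weight_law m)" "k \<in> {1..d}" "i \<in> {1..m}"
  shows "0 < S (k, i)"
proof -
  have "S (k, i) \<in> space (H k)"
    using assms by (force simp: space_PiM dest: PiE_mem)
  also have "space (H k) = {0<..}"
    using sets_eq_imp_space_eq[OF sets_H] assms by (simp add: space_restrict_space)
  finally show ?thesis by simp
qed

lemma atom_in: "\<tau> \<in> space (atom_law m) \<Longrightarrow> i \<in> {1..m} \<Longrightarrow> \<tau> i \<in> \<Theta>"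
  by (auto simp: space_PiM space_P0 dest: PiE_mem)

lemma measurable_weight:
  assumes "k \<in> {1..d}" "i \<in> {1..m}"
  shows "(\<lambda>S. S (k, i)) \<in> borel_measurable (weight_law m)"
proof -
  have "(\<lambda>S. S (k, i)) \<in> measurable (weight_law m) (H k)"
    using measurable_component_singleton[of "(k, i)" "{1..d} \<times> {1..m}" "\<lambda>(k, i). H k"] assms
    by simp
  moreover have "(\<lambda>x. x) \<in> borel_measurable (H k)"
    by (subst measurable_cong_sets[OF sets_H[OF assms(1)] refl])
       (intro measurable_restrict_space1, simp)
  ultimately show ?thesis
    by (rule measurable_compose)
qed

lemma measurable_weight_compose [measurable (raw)]:
  assumes "f \<in> measurable N (weight_law m)" "k \<in> {1..d}" "i \<in> {1..m}"
  shows "(\<lambda>x. f x (k, i)) \<in> borel_measurable N"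
  using measurable_compose[OF assms(1) measurable_weight[OF assms(2,3)]] .

text \<open>A map into the space of probability measures is measurable once its evaluations at
  measurable sets are. Here each evaluation is an explicit ratio of finite sums in the coordinates.
  The condition \<open>1 \<le> m\<close> ensures that the values are probability measures.\<close>

lemma measurable_nifpp_map:
  assumes m: "1 \<le> m"
  shows "(\<lambda>(S, \<tau>). \<lambda>j\<in>{1..d}. normalized (weighted_atoms \<Theta> m (\<lambda>i. S (j, i)) \<tau>))
    \<in> measurable (joint_law m) (prob_vectors d \<Theta>)"
proof -
  have "(\<lambda>x. normalized (weighted_atoms \<Theta> m (\<lambda>i. fst x (j, i)) (snd x)))
      \<in> measurable (joint_law m) (prob_algebra (borel_on \<Theta>))" if j: "j \<in> {1..d}" for j
  proof (rule measurable_prob_algebraI)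
    fix x assume x: "x \<in> space (joint_law m)"
    show "prob_space (normalized (weighted_atoms \<Theta> m (\<lambda>i. fst x (j, i)) (snd x)))"
      using x j m
      by (intro prob_space_normalized_weighted_atoms)
         (auto simp: space_pair_measure intro!: weight_pos atom_in)
  next
    show "(\<lambda>x. normalized (weighted_atoms \<Theta> m (\<lambda>i. fst x (j, i)) (snd x)))
      \<in> measurable (joint_law m) (subprob_algebra (borel_on \<Theta>))"
    proof (rule measurable_subprob_algebra)
      fix x assume x: "x \<in> space (joint_law m)"
      show "subprob_space (normalized (weighted_atoms \<Theta> m (\<lambda>i. fst x (j, i)) (snd x)))"
        using x j m
        by (intro prob_space_imp_subprob_space prob_space_normalized_weighted_atoms)
           (auto simp: space_pair_measure intro!: weight_pos atom_in)
    next
      fix B assume B: "B \<in> sets (borel_on \<Theta>)"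
      then have [measurable]: "B \<in> sets P0"
        by (simp add: sets_P0)
      have "(\<lambda>x. ennreal ((\<Sum>i=1..m. fst x (j, i) * indicator B (snd x i)) / (\<Sum>i=1..m. fst x (j, i))))
          \<in> borel_measurable (joint_law m)"
        using j by measurable
      then show "(\<lambda>x. emeasure (normalized (weighted_atoms \<Theta> m (\<lambda>i. fst x (j, i)) (snd x))) B)
          \<in> borel_measurable (joint_law m)"
      proof (rule measurable_cong[THEN iffD1, rotated])
        fix x assume "x \<in> space (joint_law m)"
        then show "ennreal ((\<Sum>i=1..m. fst x (j, i) * indicator B (snd x i)) / (\<Sum>i=1..m. fst x (j, i)))
          = emeasure (normalized (weighted_atoms \<Theta> m (\<lambda>i. fst x (j, i)) (snd x))) B"
          using j m B
          by (intro emeasure_normalized_weighted_atoms[symmetric])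
             (auto simp: space_pair_measure intro!: weight_pos atom_in)
      qed
    qed simp
  qed
  then show ?thesis
    by (simp add: case_prod_beta measurable_restrict)
qed

text \<open>This includes \<open>m = 0\<close>, where the map is not measurable into the space of probability
  vectors: \<open>distr\<close> is then junk, but its total mass is still at most \<open>1\<close>.\<close>
lemma nifpp_given_subprob: "nifpp_given d \<Theta> H P0 m \<in> space (subprob_algebra (prob_vectors d \<Theta>))"
proof -
  interpret J: prob_space "joint_law m" by (rule prob_joint_law)
  \<comment> \<open>A subprobability space has to be nonempty; a Dirac mass at a point of
    \<open>\<Theta>\<close> inhabits each factor of \<open>prob_vectors d \<Theta>\<close>.\<close>
  have "return (borel_on \<Theta>) x \<in> space (prob_algebra (borel_on \<Theta>))" if "x \<in> \<Theta>" for x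
    using that by (auto simp: space_prob_algebra space_restrict_space intro!: prob_space_return)
  moreover have "\<Theta> \<noteq> {}"
    using prob_space.not_empty[OF prob_P0] space_P0 by simp
  ultimately have "space (prob_vectors d \<Theta>) \<noteq> {}"
    by (force simp: space_PiM PiE_eq_empty_iff)
  moreover have "emeasure (nifpp_given d \<Theta> H P0 m) (space (nifpp_given d \<Theta> H P0 m)) \<le> 1"
    unfolding nifpp_given_def distr_def emeasure_measure_of_conv
    by (auto intro!: J.measure_le_1)
  ultimately show ?thesis
    by (auto simp: space_subprob_algebra nifpp_given_def intro!: subprob_spaceI)
qed

lemma integral_nifpp_given:
  assumes "1 \<le> m" and f: "f \<in> borel_measurable (prob_vectors d \<Theta>)"
  shows "(\<integral>p. f p \<partial>nifpp_given d \<Theta> H P0 m) = (\<integral>x. (f (\<lambda>j\<in>{1..d}.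
    normalized (weighted_atoms \<Theta> m (\<lambda>i. fst x (j, i)) (snd x))) :: real) \<partial>joint_law m)"
  unfolding nifpp_given_def
  by (subst integral_distr[OF measurable_nifpp_map[OF assms(1)] f]) (simp add: case_prod_beta)

text \<open>Conditioning on the number of atoms. The kernel starts from a discrete space, so its
  measurability reduces to its values being subprobability measures, including the junk value at 0.
  The bound on \<open>f\<close> lets the integral over the mixture be iterated.\<close>

lemma integral_vec_nifpp:
  fixes f :: "(nat \<Rightarrow> 'a measure) \<Rightarrow> real"
  assumes "f \<in> borel_measurable (prob_vectors d \<Theta>)"
    and "\<And>p. p \<in> space (prob_vectors d \<Theta>) \<Longrightarrow> \<bar>f p\<bar> \<le> 1"
  shows "(\<integral>p. f p \<partial>vec_nifpp d \<Theta> q H P0) = (\<integral>m. (\<integral>p. f p \<partial>nifpp_given d \<Theta> H P0 m) \<partial>measure_pmf q)"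
  unfolding vec_nifpp_def
proof (rule integral_bind[OF assms])
  show "nifpp_given d \<Theta> H P0 \<in> measurable (measure_pmf q) (subprob_algebra (prob_vectors d \<Theta>))"
    using nifpp_given_subprob by auto
  show "finite_measure (measure_pmf q)"
    by unfold_locales
  show "AE m in measure_pmf q. emeasure (nifpp_given d \<Theta> H P0 m) (space (nifpp_given d \<Theta> H P0 m)) \<le> ennreal 1"
    using nifpp_given_subprob
    by (auto simp: space_subprob_algebra intro!: AE_I2 subprob_space.emeasure_space_le_1)
qed

section \<open>Evaluation of the random measures and bounds on the weight overlap\<close>

lemma measurable_coordinate_measure:
  assumes "k \<in> {1..d}" "B \<in> sets (borel_on \<Theta>)"
  shows "(\<lambda>p. measure (p k) B) \<in> borel_measurable (prob_vectors d \<Theta>)"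
  using measurable_compose[OF measurable_component_singleton[OF assms(1)] measurable_measure_prob_algebra[OF assms(2)]] .

lemma prob_coordinate:
  assumes "k \<in> {1..d}" "p \<in> space (prob_vectors d \<Theta>)"
  shows "prob_space (p k)"
  using assms by (auto simp: space_PiM space_prob_algebra dest: PiE_mem)

lemma overlap_ratio_bounds:
  assumes "S \<in> space (weight_law m)" "j \<in> {1..d}" "l \<in> {1..d}"
  shows "\<bar>(\<Sum>i=1..m. S (j, i) * S (l, i)) / ((\<Sum>i=1..m. S (j, i)) * (\<Sum>i=1..m. S (l, i)))\<bar> \<le> (1::real)"
proof -
  have nonneg: "0 \<le> S (k, i)" if "k \<in> {1..d}" "i \<in> {1..m}" for k i
    using weight_pos[OF assms(1) that] by simp
  have "(\<Sum>i=1..m. S (j, i) * S (l, i)) \<le> (\<Sum>i=1..m. S (j, i)) * (\<Sum>i=1..m. S (l, i))"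
    using nonneg assms by (intro sum_mult_le_mult_sum) auto
  moreover have "0 \<le> (\<Sum>i=1..m. S (j, i) * S (l, i))"
    using nonneg assms by (intro sum_nonneg) auto
  \<comment> \<open>The case \<open>b = 0\<close> occurs for \<open>m = 0\<close>, where both sums
    are empty and the quotient is 0 by convention; the bound thus holds for every
    \<open>m\<close>.\<close>
  moreover have "\<bar>a / b\<bar> \<le> 1" if "a \<le> b" "0 \<le> a" for a b :: real
    using that by (cases "b = 0") auto
  ultimately show ?thesis
    by blast
qed

lemma integrable_overlap:
  assumes "j \<in> {1..d}" "l \<in> {1..d}"
  shows "integrable (weight_law m) (\<lambda>S. (\<Sum>i=1..m. S (j, i) * S (l, i)) /
    ((\<Sum>i=1..m. S (j, i)) * (\<Sum>i=1..m. S (l, i))))"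
proof -
  interpret W: prob_space "weight_law m" by (rule prob_weight_law)
  show ?thesis
    using assms overlap_ratio_bounds[OF _ assms]
    by (intro W.integrable_const_bound[where B = 1]) (auto intro!: borel_measurable_divide
      borel_measurable_times borel_measurable_sum measurable_weight)
qed

text \<open>The bound is uniform in \<open>m\<close>, which makes the overlap integrable with
  respect to the law of the number of atoms.\<close>

lemma abs_mean_weight_overlap_le_1:
  assumes "j \<in> {1..d}" "l \<in> {1..d}"
  shows "\<bar>mean_weight_overlap d H j l m\<bar> \<le> 1"
proof -
  interpret W: prob_space "weight_law m" by (rule prob_weight_law)
  let ?f = "\<lambda>S. (\<Sum>i=1..m. S (j, i) * S (l, i)) /
    ((\<Sum>i=1..m. S (j, i)) * (\<Sum>i=1..m. S (l, i))) :: real"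
  have "\<bar>mean_weight_overlap d H j l m\<bar> \<le> (\<integral>S. \<bar>?f S\<bar> \<partial>weight_law m)"
    unfolding mean_weight_overlap_def by (rule integral_abs_bound)
  also have "\<dots> \<le> (\<integral>S. 1 \<partial>weight_law m)"
    using overlap_ratio_bounds[OF _ assms] integrable_overlap[OF assms]
    by (intro integral_mono integrable_abs) auto
  finally show ?thesis
    by (simp add: W.prob_space)
qed

section \<open>Mixed moments of the random measures\<close>

lemma integral_product_nifpp_given:
  assumes m: "1 \<le> m" and j: "j \<in> {1..d}" and l: "l \<in> {1..d}"
    and B: "B \<in> sets (borel_on \<Theta>)" and C: "C \<in> sets (borel_on \<Theta>)"
  shows "(\<integral>p. measure (p j) B * measure (p l) C \<partial>nifpp_given d \<Theta> H P0 m) =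
    mean_weight_overlap d H j l m * (measure P0 (B \<inter> C) - measure P0 B * measure P0 C)
      + measure P0 B * measure P0 C"
proof -
  interpret W: prob_space "weight_law m" by (rule prob_weight_law)
  interpret T: prob_space "atom_law m" by (rule prob_atom_law)
  interpret WT: pair_prob_space "weight_law m" "atom_law m" ..
  have [measurable]: "B \<in> sets P0" "C \<in> sets P0"
    using B C by (simp_all add: sets_P0)
  define w where "w k S i = S (k, i) / (\<Sum>i=1..m. S (k, i))"
    for k i :: nat and S :: "nat \<times> nat \<Rightarrow> real"
  \<comment> \<open>The covariance of the indicators of \<open>B\<close> and \<open>C\<close> under
    \<open>P0\<close>: the excess contributed by a shared atom over two distinct atoms.\<close>
  define v where "v = measure P0 (B \<inter> C) - measure P0 B * measure P0 C"
  have sum_pos: "0 < (\<Sum>i=1..m. S (k, i))" if "S \<in> space (weight_law m)" "k \<in> {1..d}" for k S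
    using m weight_pos[OF that] by (intro sum_pos) auto
  have sum_w: "(\<Sum>i=1..m. w k S i) = 1" if "S \<in> space (weight_law m)" "k \<in> {1..d}" for k S
    using sum_pos[OF that] by (simp add: w_def flip: sum_divide_distrib)
  define F where "F x = (\<Sum>i=1..m. w j (fst x) i * indicator B (snd x i)) *
    (\<Sum>i=1..m. w l (fst x) i * indicator C (snd x i))" for x :: "(nat \<times> nat \<Rightarrow> real) \<times> (nat \<Rightarrow> 'a)"
  have eq: "measure (normalized (weighted_atoms \<Theta> m (\<lambda>i. S (k, i)) \<tau>)) D =
      (\<Sum>i=1..m. w k S i * indicator D (\<tau> i))"
    if "S \<in> space (weight_law m)" "\<tau> \<in> space (atom_law m)" "k \<in> {1..d}" "D \<in> sets (borel_on \<Theta>)"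
    for S \<tau> k D
  proof -
    have "measure (normalized (weighted_atoms \<Theta> m (\<lambda>i. S (k, i)) \<tau>)) D =
        (\<Sum>i=1..m. S (k, i) * indicator D (\<tau> i)) / (\<Sum>i=1..m. S (k, i))"
      using that m by (intro measure_normalized_weighted_atoms weight_pos atom_in)
    then show ?thesis
      by (simp only: w_def sum_divide_distrib times_divide_eq_left)
  qed
  have "(\<integral>p. measure (p j) B * measure (p l) C \<partial>nifpp_given d \<Theta> H P0 m) = (\<integral>x. F x \<partial>joint_law m)"
    using j l B C eq
    by (subst integral_nifpp_given[OF m])
       (auto intro!: borel_measurable_times measurable_coordinate_measure Bochner_Integration.integral_cong
             simp: F_def space_pair_measure)
  \<comment> \<open>Fubini, with the atoms integrated first for fixed weights. It applies because
    both factors of \<open>F\<close> are partial sums of normalized weights, so that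
    \<open>F\<close> is bounded by 1.\<close>
  also have "\<dots> = (\<integral>S. (\<integral>\<tau>. F (S, \<tau>) \<partial>atom_law m) \<partial>weight_law m)"
  proof (rule WT.integral_fst'[symmetric], rule WT.integrable_const_bound[where B = 1])
    show "F \<in> borel_measurable (joint_law m)"
      unfolding F_def w_def using j l by measurable
    have "\<bar>F (S, \<tau>)\<bar> \<le> 1" if S: "S \<in> space (weight_law m)" for S \<tau>
    proof -
      have w: "0 \<le> w k S i" if "k \<in> {1..d}" "i \<in> {1..m}" for k i
        using sum_pos[OF S that(1)] weight_pos[OF S that] by (simp add: w_def)
      have "\<bar>\<Sum>i=1..m. w k S i * indicator D (\<tau> i)\<bar> \<le> 1" if "k \<in> {1..d}" for k D
      proof -
        have "\<bar>\<Sum>i=1..m. w k S i * indicator D (\<tau> i)\<bar> \<le> (\<Sum>i=1..m. \<bar>w k S i * indicator D (\<tau> i)\<bar>)"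
          by (rule sum_abs)
        also have "\<dots> \<le> (\<Sum>i=1..m. w k S i)"
          using w[OF that] by (intro sum_mono) (auto split: split_indicator)
        finally show ?thesis
          using sum_w[OF S that] by simp
      qed
      then show ?thesis
        using j l by (auto simp: F_def abs_mult intro!: mult_le_one)
    qed
    then show "AE x in joint_law m. norm (F x) \<le> 1"
      by (intro AE_I2) (auto simp: space_pair_measure)
  qed
  also have "\<dots> = (\<integral>S. (\<Sum>i=1..m. S (j, i) * S (l, i)) / ((\<Sum>i=1..m. S (j, i)) * (\<Sum>i=1..m. S (l, i))) * v
      + measure P0 B * measure P0 C \<partial>weight_law m)"
  proof (rule Bochner_Integration.integral_cong[OF refl])
    fix S assume S: "S \<in> space (weight_law m)"
    let ?I = "\<lambda>i k \<tau>. indicator B (\<tau> i) * indicator C (\<tau> k) :: real"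
    have int: "integrable (atom_law m) (?I i k)" if "i \<in> {1..m}" "k \<in> {1..m}" for i k
      using that by (intro T.integrable_const_bound[where B = 1]) (auto split: split_indicator)
    have "(\<integral>\<tau>. F (S, \<tau>) \<partial>atom_law m)
        = (\<integral>\<tau>. (\<Sum>i=1..m. \<Sum>k=1..m. w j S i * w l S k * ?I i k \<tau>) \<partial>atom_law m)"
      by (simp only: F_def fst_conv snd_conv sum_product mult_ac)
    also have "\<dots> = (\<Sum>i=1..m. \<Sum>k=1..m. w j S i * w l S k * (\<integral>\<tau>. ?I i k \<tau> \<partial>atom_law m))"
      by (simp only: Bochner_Integration.integral_sum Bochner_Integration.integrable_sum
          integrable_mult_right integral_mult_right_zero int cong: sum.cong)
    \<comment> \<open>Every pair of indices contributes the product of the \<open>P0\<close>-masses,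
      and the diagonal adds \<open>v\<close>, since \<open>P0 (B \<inter> C)\<close> exceeds that
      product by exactly \<open>v\<close>.\<close>
    also have "\<dots> = (\<Sum>i=1..m. \<Sum>k=1..m. w j S i * w l S k *
        ((if i = k then v else 0) + measure P0 B * measure P0 C))"
      by (intro sum.cong refl)
         (subst integral_indicator_pair_PiM[OF prob_P0], auto simp: v_def)
    also have "\<dots> = (\<Sum>i=1..m. \<Sum>k=1..m. (if i = k then w j S i * w l S k * v else 0)
        + w j S i * w l S k * (measure P0 B * measure P0 C))"
      by (intro sum.cong refl) (auto simp: algebra_simps)
    also have "\<dots> = (\<Sum>i=1..m. w j S i * w l S i * v)
        + (\<Sum>i=1..m. w j S i) * (\<Sum>k=1..m. w l S k) * (measure P0 B * measure P0 C)"
      by (simp only: sum.distrib sum_product) (simp add: sum_distrib_right)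
    \<comment> \<open>The normalized weights of each group sum to 1, so the constant part survives
      with coefficient 1.\<close>
    also have "\<dots> = (\<Sum>i=1..m. w j S i * w l S i) * v + measure P0 B * measure P0 C"
      using S j l by (simp add: sum_w sum_distrib_right)
    also have "(\<Sum>i=1..m. w j S i * w l S i) =
        (\<Sum>i=1..m. S (j, i) * S (l, i)) / ((\<Sum>i=1..m. S (j, i)) * (\<Sum>i=1..m. S (l, i)))"
      by (simp add: w_def sum_divide_distrib)
    finally show "(\<integral>\<tau>. F (S, \<tau>) \<partial>atom_law m) =
        (\<Sum>i=1..m. S (j, i) * S (l, i)) / ((\<Sum>i=1..m. S (j, i)) * (\<Sum>i=1..m. S (l, i))) * v
        + measure P0 B * measure P0 C" .
  qed
  also have "\<dots> = mean_weight_overlap d H j l m * v + measure P0 B * measure P0 C"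
    using integrable_overlap[OF j l, of m]
    by (simp add: mean_weight_overlap_def W.prob_space del: times_divide_eq_left)
  finally show ?thesis
    by (simp add: v_def)
qed

text \<open>The conditional identity is affine in the overlap, so averaging over \<open>q\<close>
  replaces the overlap by its mean \<open>c\<close>. The support condition on \<open>q\<close>
  discards the junk case of no atoms. The result is arranged as the mixture that the tie probability
  requires.\<close>

lemma integral_product_vec_nifpp:
  assumes q: "set_pmf q \<subseteq> {1..}" and j: "j \<in> {1..d}" and l: "l \<in> {1..d}"
    and B: "B \<in> sets (borel_on \<Theta>)" and C: "C \<in> sets (borel_on \<Theta>)"
  defines "c \<equiv> measure_pmf.expectation q (mean_weight_overlap d H j l)"
  shows "(\<integral>p. measure (p j) B * measure (p l) C \<partial>vec_nifpp d \<Theta> q H P0) =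
    c * measure P0 (B \<inter> C) + (1 - c) * (measure P0 B * measure P0 C)"
proof -
  have "(\<integral>p. measure (p j) B * measure (p l) C \<partial>vec_nifpp d \<Theta> q H P0)
      = (\<integral>m. (\<integral>p. measure (p j) B * measure (p l) C \<partial>nifpp_given d \<Theta> H P0 m) \<partial>measure_pmf q)"
    using j l B C prob_space.prob_le_1[OF prob_coordinate]
    by (intro integral_vec_nifpp borel_measurable_times measurable_coordinate_measure)
       (auto simp: abs_mult intro!: mult_le_one)
  also have "\<dots> = (\<integral>m. mean_weight_overlap d H j l m * (measure P0 (B \<inter> C) - measure P0 B * measure P0 C)
      + measure P0 B * measure P0 C \<partial>measure_pmf q)"
    using q by (intro integral_cong_AE)
      (auto simp: AE_measure_pmf_iff intro!: integral_product_nifpp_given[OF _ j l B C])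
  also have "\<dots> = c * (measure P0 (B \<inter> C) - measure P0 B * measure P0 C) + measure P0 B * measure P0 C"
  proof -
    have "integrable (measure_pmf q) (mean_weight_overlap d H j l)"
      using abs_mean_weight_overlap_le_1[OF j l]
      by (intro measure_pmf.integrable_const_bound[where B = 1]) auto
    then show ?thesis
      by (simp add: c_def)
  qed
  finally show ?thesis
    by (simp add: algebra_simps)
qed

text \<open>The mean is the mixed moment with second set \<open>\<Theta>\<close>, where every
  probability measure takes the value 1; both parts of the mixture then equal \<open>P0 B\<close>
  and the coefficients add up to 1.\<close>

lemma integral_coordinate_vec_nifpp:
  assumes q: "set_pmf q \<subseteq> {1..}" and j: "j \<in> {1..d}" and B: "B \<in> sets (borel_on \<Theta>)"
  shows "(\<integral>p. measure (p j) B \<partial>vec_nifpp d \<Theta> q H P0) = measure P0 B"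
proof -
  have \<Theta>: "\<Theta> \<in> sets (borel_on \<Theta>)"
    using sets.top[of "borel_on \<Theta>"] by (simp add: space_restrict_space)
  have sets_v: "sets (vec_nifpp d \<Theta> q H P0) = sets (prob_vectors d \<Theta>)"
    unfolding vec_nifpp_def by (intro sets_bind) (auto simp: nifpp_given_def)
  have "(\<integral>p. measure (p j) B \<partial>vec_nifpp d \<Theta> q H P0)
      = (\<integral>p. measure (p j) B * measure (p j) \<Theta> \<partial>vec_nifpp d \<Theta> q H P0)"
  proof (rule Bochner_Integration.integral_cong[OF refl])
    fix p assume "p \<in> space (vec_nifpp d \<Theta> q H P0)"
    then have p: "p \<in> space (prob_vectors d \<Theta>)"
      using sets_eq_imp_space_eq[OF sets_v] by simp
    then have "sets (p j) = sets (borel_on \<Theta>)"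
      using j by (auto simp: space_PiM space_prob_algebra dest: PiE_mem)
    from sets_eq_imp_space_eq[OF this] have "space (p j) = \<Theta>"
      by (simp add: space_restrict_space)
    then show "measure (p j) B = measure (p j) B * measure (p j) \<Theta>"
      using prob_space.prob_space[OF prob_coordinate[OF j p]] by simp
  qed
  also have "\<dots> = measure P0 B"
  proof -
    have "B \<inter> \<Theta> = B"
      using sets.sets_into_space[OF B] by (auto simp: space_restrict_space)
    moreover have "measure P0 \<Theta> = 1"
      using prob_space.prob_space[OF prob_P0] space_P0 by simp
    ultimately show ?thesis
      by (simp add: integral_product_vec_nifpp[OF q j j B \<Theta>] algebra_simps)
  qed
  finally show ?thesis .
qed

end

section \<open>Covariances, tie probabilities and the correlation\<close>

theorem mainTheorem6:
  fixes d :: nat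
    and \<Theta> :: "(real ^ 's) set"
    and P0 :: "(real ^ 's) measure"
    and q :: "nat pmf"
    and h :: "real \<Rightarrow> real \<Rightarrow> real"
    and \<gamma> :: "nat \<Rightarrow> real"
    and H :: "nat \<Rightarrow> real measure"
    and \<Omega> :: "'w measure"
    and P :: "'w \<Rightarrow> nat \<Rightarrow> (real ^ 's) measure"
    and j l :: nat
    and X Y X1 X2 Y1 Y2 :: "'w \<Rightarrow> real ^ 's"
    and A :: "(real ^ 's) set"
  assumes "d \<ge> 1"
    and "\<Theta> \<in> sets borel"
    and "sets P0 = sets (borel_on \<Theta>)" and "prob_space P0" and "diffuse P0"
    and "set_pmf q \<subseteq> {1..}"
    and "\<And>k. k \<in> {1..d} \<Longrightarrow> \<gamma> k > 0"
    and "\<And>k s. k \<in> {1..d} \<Longrightarrow> s > 0 \<Longrightarrow> h s (\<gamma> k) \<ge> 0"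
    and "\<And>k. k \<in> {1..d} \<Longrightarrow> (\<lambda>s. h s (\<gamma> k)) \<in> borel_measurable (borel_on {0<..})"
    and "\<And>k. k \<in> {1..d} \<Longrightarrow> H k = half_line_law (\<lambda>s. h s (\<gamma> k))"
    and "\<And>k. k \<in> {1..d} \<Longrightarrow> prob_space (H k)"
    and "prob_space \<Omega>"
    and "P \<in> measurable \<Omega> (prob_vectors d \<Theta>)"
    and "distr \<Omega> (prob_vectors d \<Theta>) P = vec_nifpp d \<Theta> q H P0"
    and "j \<in> {1..d}" and "l \<in> {1..d}"
    and "cond_indep_draws \<Omega> d \<Theta> P j l X Y"
    and "cond_indep_draws \<Omega> d \<Theta> P j j X1 X2"
    and "cond_indep_draws \<Omega> d \<Theta> P l l Y1 Y2"
    and "A \<in> sets (borel_on \<Theta>)" and "0 < measure P0 A" and "measure P0 A < 1"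
  shows "corr \<Omega> (\<lambda>\<omega>. measure (P \<omega> j) A) (\<lambda>\<omega>. measure (P \<omega> l) A) =
           measure \<Omega> {\<omega>\<in>space \<Omega>. distinct_count X Y \<omega> = 1} /
           sqrt (measure \<Omega> {\<omega>\<in>space \<Omega>. distinct_count X1 X2 \<omega> = 1} *
                 measure \<Omega> {\<omega>\<in>space \<Omega>. distinct_count Y1 Y2 \<omega> = 1})
    \<and> (\<forall>B\<in>sets (borel_on \<Theta>). 0 < measure P0 B \<and> measure P0 B < 1 \<longrightarrow>
           corr \<Omega> (\<lambda>\<omega>. measure (P \<omega> j) B) (\<lambda>\<omega>. measure (P \<omega> l) B) =
           corr \<Omega> (\<lambda>\<omega>. measure (P \<omega> j) A) (\<lambda>\<omega>. measure (P \<omega> l) A))"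
proof -
  have ne: "sets (H k) = sets (borel_on {0<..})" if "k \<in> {1..d}" for k
    using assms(10)[OF that] by simp
  interpret nifpp_setting d \<Theta> H P0
    by (rule nifpp_setting.intro[OF assms(3,4) ne assms(11)])
  interpret \<Omega>: prob_space \<Omega> by fact
  note P = assms(13) and P_law = assms(14) and q = assms(6)
  define c where "c j l = measure_pmf.expectation q (mean_weight_overlap d H j l)" for j l
  \<comment> \<open>Expectations of functions of \<open>P\<close> depend only on its law, so the
    moments of \<open>vec_nifpp\<close> carry over to \<open>\<Omega>\<close>.\<close>
  have int: "(\<integral>\<omega>. f (P \<omega>) \<partial>\<Omega>) = (\<integral>p. f p \<partial>vec_nifpp d \<Theta> q H P0)"
    if "f \<in> borel_measurable (prob_vectors d \<Theta>)" for f :: "_ \<Rightarrow> real"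
    using integral_distr[OF P that] P_law by simp
  have mean: "(\<integral>\<omega>. measure (P \<omega> j) B \<partial>\<Omega>) = measure P0 B"
    if "j \<in> {1..d}" "B \<in> sets (borel_on \<Theta>)" for j B
    using that q
    by (simp add: int[OF measurable_coordinate_measure] integral_coordinate_vec_nifpp)
  have mixed: "(\<integral>\<omega>. measure (P \<omega> j) B * measure (P \<omega> l) C \<partial>\<Omega>) =
      c j l * measure P0 (B \<inter> C) + (1 - c j l) * (measure P0 B * measure P0 C)"
    if "j \<in> {1..d}" "l \<in> {1..d}" "B \<in> sets (borel_on \<Theta>)" "C \<in> sets (borel_on \<Theta>)" for j l B C
    using int[OF borel_measurable_times[OF measurable_coordinate_measure measurable_coordinate_measure],
        of j B l C] that q
    by (simp add: integral_product_vec_nifpp c_def)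
  \<comment> \<open>With b = \<open>measure P0 B\<close>, the mixed moment is c b + (1 - c) b^2 and
    both means are b, so the covariance is c b (1 - b). Taking \<open>j = l\<close> gives the
    variances.\<close>
  have cov: "covariance \<Omega> (\<lambda>\<omega>. measure (P \<omega> j) B) (\<lambda>\<omega>. measure (P \<omega> l) B) =
      c j l * (measure P0 B * (1 - measure P0 B))"
    if "j \<in> {1..d}" "l \<in> {1..d}" "B \<in> sets (borel_on \<Theta>)" for j l B
  proof -
    have meas: "(\<lambda>\<omega>. measure (P \<omega> k) B) \<in> borel_measurable \<Omega>" if "k \<in> {1..d}" for k
      using measurable_compose[OF P measurable_coordinate_measure[OF that \<open>B \<in> _\<close>]] .
    have le1: "measure (P \<omega> k) B \<le> 1" if "k \<in> {1..d}" "\<omega> \<in> space \<Omega>" for k \<omega>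
      using prob_space.prob_le_1[OF prob_coordinate[OF that(1) measurable_space[OF P that(2)]]] .
    have i1: "integrable \<Omega> (\<lambda>\<omega>. measure (P \<omega> k) B)" if "k \<in> {1..d}" for k
      using meas[OF that] le1[OF that] by (intro \<Omega>.integrable_const_bound[where B = 1]) auto
    have i2: "integrable \<Omega> (\<lambda>\<omega>. measure (P \<omega> j) B * measure (P \<omega> l) B)"
      using meas le1 that
      by (intro \<Omega>.integrable_const_bound[where B = 1])
         (auto simp: abs_mult intro!: mult_le_one borel_measurable_times)
    let ?b = "measure P0 B"
    have "covariance \<Omega> (\<lambda>\<omega>. measure (P \<omega> j) B) (\<lambda>\<omega>. measure (P \<omega> l) B) =
        (\<integral>\<omega>. measure (P \<omega> j) B * measure (P \<omega> l) B - ?b * measure (P \<omega> j) B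
          - ?b * measure (P \<omega> l) B + ?b * ?b \<partial>\<Omega>)"
      using that by (simp add: covariance_def mean algebra_simps)
    also have "\<dots> = (c j l * ?b + (1 - c j l) * (?b * ?b)) - ?b * ?b - ?b * ?b + ?b * ?b"
      using that i1 i2 by (simp add: mean mixed \<Omega>.prob_space)
    finally show ?thesis
      by (simp add: algebra_simps)
  qed
  \<comment> \<open>Stated for arbitrary groups and draws, as it is used for the pairs (j, l), (j,
    j) and (l, l).\<close>
  have tie: "measure \<Omega> {\<omega>\<in>space \<Omega>. distinct_count X Y \<omega> = 1} = c j l"
    if jl: "j \<in> {1..d}" "l \<in> {1..d}" and XY: "cond_indep_draws \<Omega> d \<Theta> P j l X Y" for j l X Y
  proof -
    have "measure \<Omega> {\<omega>\<in>space \<Omega>. X \<omega> = Y \<omega>} = c j l"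
    proof (rule prob_tie_eq_mixture_weight)
      show "prob_space \<Omega>" "prob_space P0" "diffuse P0" by fact+
      show "(\<lambda>x. x) \<in> borel_measurable P0"
        by (subst measurable_cong_sets[OF sets_P0 refl]) (intro measurable_restrict_space1, simp)
      show "X \<in> measurable \<Omega> P0" "Y \<in> measurable \<Omega> P0"
        using XY by (simp_all add: cond_indep_draws_def measurable_cong_sets[OF refl sets_P0])
      fix B C assume BC: "B \<in> sets P0" "C \<in> sets P0"
      \<comment> \<open>Testing against the whole space of probability vectors removes the condition
        on \<open>P\<close> and leaves the joint law of \<open>X\<close> and
        \<open>Y\<close>.\<close>
      let ?V = "space (prob_vectors d \<Theta>)"
      have "measure \<Omega> {\<omega>\<in>space \<Omega>. X \<omega> \<in> B \<and> Y \<omega> \<in> C}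
          = measure \<Omega> {\<omega>\<in>space \<Omega>. P \<omega> \<in> ?V \<and> X \<omega> \<in> B \<and> Y \<omega> \<in> C}"
        using measurable_space[OF P] by (intro arg_cong[where f = "measure _"]) blast
      also have "\<dots> = (\<integral>\<omega>. indicator ?V (P \<omega>) * measure (P \<omega> j) B * measure (P \<omega> l) C \<partial>\<Omega>)"
        using XY BC sets.top[of "prob_vectors d \<Theta>"] unfolding cond_indep_draws_def sets_P0 by blast
      also have "\<dots> = (\<integral>\<omega>. measure (P \<omega> j) B * measure (P \<omega> l) C \<partial>\<Omega>)"
        using measurable_space[OF P] by (intro Bochner_Integration.integral_cong) auto
      finally show "measure \<Omega> {\<omega>\<in>space \<Omega>. X \<omega> \<in> B \<and> Y \<omega> \<in> C} =
          c j l * measure P0 (B \<inter> C) + (1 - c j l) * (measure P0 B * measure P0 C)"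
        using mixed[OF jl] BC by (simp add: sets_P0)
    qed
    moreover have "distinct_count X Y \<omega> = 1 \<longleftrightarrow> X \<omega> = Y \<omega>" for \<omega>
      by (auto simp: distinct_count_def card_insert_if)
    ultimately show ?thesis
      by simp
  qed
  \<comment> \<open>The right-hand side does not mention \<open>B\<close>, so proving this for every
    admissible \<open>B\<close> also yields the independence of the chosen set.\<close>
  have corr: "corr \<Omega> (\<lambda>\<omega>. measure (P \<omega> j) B) (\<lambda>\<omega>. measure (P \<omega> l) B) =
      c j l / sqrt (c j j * c l l)"
    if B: "B \<in> sets (borel_on \<Theta>)" "0 < measure P0 B" "measure P0 B < 1" for B
  proof -
    \<comment> \<open>The common factor of the covariance and of both variances; being positive, it
      cancels against the square root of its square.\<close>
    define v where "v = measure P0 B * (1 - measure P0 B)"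
    have v: "0 < v"
      using B by (simp add: v_def)
    have "sqrt (c j j * v * (c l l * v)) = sqrt (c j j * c l l * v\<^sup>2)"
      by (simp add: power2_eq_square mult_ac)
    also have "\<dots> = sqrt (c j j * c l l) * v"
      using v by (simp add: real_sqrt_mult)
    finally show ?thesis
      using v B(1) assms(15,16) by (simp add: corr_def cov flip: v_def)
  qed
  show ?thesis
    using corr assms(20-22) tie[OF assms(15,16,17)] tie[OF assms(15,15,18)] tie[OF assms(16,16,19)]
    by simp
qed

end
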